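(* Let $m\ge1$ and let $k_1,\ldots,k_m$, $n_1,\ldots,n_m$ be integers with $n_i \geq k_i > 0$ for all $i \in [m]$. Let $M$ be the complement of a $(k_1, \ldots, k_m; n_1, \ldots, n_m)$ circulant block diagonal matrix. Suppose that for each $i \in [m]$, $k_i$ divides $n_i$, and that some $i \in [m]$ satisfies $n_i > k_i >1$. Then \[\mathrm{rank}_{\mathrm{bin}}(M) \geq \mathrm{rank}_{\mathbb{R}}(M) + 1.\]
   Context: For integers $n \ge k \ge 0$, $D_{n,k}$ denotes the $n\times n$ circulant $0,1$ matrix whose first row consists of $n-k$ ones followed by $k$ zeros, each subsequent row being the cyclic shift of the previous row by one position to the right. For integers $n_i \ge k_i \ge 0$ ($i\in[m]$), a matrix is called $(k_1,\ldots,k_m;n_1,\ldots,n_m)$ circulant block diagonal if it is a block matrix with $m$ diagonal blocks whose $i$th diagonal block is $D_{n_i,n_i-k_i}$ and all of whose other entries are zero. The complement of a $0,1$ matrix is obtained by swapping zeros and ones. The binary rank $\mathrm{rank}_{\mathrm{bin}}(A)$ of a $0,1$ matrix $A$ is the smallest number of combinatorial rectangles (all-one submatrices indexed by a set of rows times a set of columns) that partition the ones of $A$ (equivalently, the smallest inner dimension of a factorization $A=A_1A_2$ over the reals with $0,1$ factors). $\mathrm{rank}_{\mathbb{R}}$ denotes the rank over the reals. *)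

theory Defs
  imports "Jordan_Normal_Form.DL_Rank" "HOL-Library.Disjoint_Sets"
begin

text \<open>Row \<open>i\<close> is \<open>v\<close> cyclically shifted \<open>i\<close> positions to the right; \<open>j + dim_vec v - i\<close> avoids
  truncated subtraction.\<close>

definition circulant_mat :: "'a vec \<Rightarrow> 'a mat" where
  "circulant_mat v = mat (dim_vec v) (dim_vec v) (\<lambda>(i, j). v $ ((j + dim_vec v - i) mod dim_vec v))"

definition D_mat :: "nat \<Rightarrow> nat \<Rightarrow> real mat" where
  "D_mat n k = circulant_mat (vec n (\<lambda>j. if j < n - k then 1 else 0))"

definition circulant_block_diag :: "nat \<Rightarrow> (nat \<Rightarrow> nat) \<Rightarrow> (nat \<Rightarrow> nat) \<Rightarrow> real mat" where
  "circulant_block_diag m k n = diag_block_mat (map (\<lambda>i. D_mat (n i) (n i - k i)) [1..<m + 1])"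

definition complement_mat :: "real mat \<Rightarrow> real mat" where
  "complement_mat A = map_mat (\<lambda>x. 1 - x) A"

definition ones :: "real mat \<Rightarrow> (nat \<times> nat) set" where
  "ones A = {(i, j). i < dim_row A \<and> j < dim_col A \<and> A $$ (i, j) = 1}"

definition rectangle_partition :: "real mat \<Rightarrow> (nat \<times> nat) set set \<Rightarrow> bool" where
  "rectangle_partition A P \<longleftrightarrow> partition_on (ones A) P \<and> (\<forall>R\<in>P. \<exists>I J. R = I \<times> J)"

definition rank_bin :: "real mat \<Rightarrow> nat" where
  "rank_bin A = (LEAST r. \<exists>P. finite P \<and> rectangle_partition A P \<and> card P = r)"

abbreviation rank_real :: "real mat \<Rightarrow> nat" where
  "rank_real A \<equiv> vec_space.rank (dim_row A) A"

text \<open>The \<open>LEAST\<close> above is attained: the singletons partition the ones of any matrix.\<close>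

lemma rank_bin_attained:
  "\<exists>P. finite P \<and> rectangle_partition A P \<and> card P = rank_bin A"
proof -
  let ?S = "(\<lambda>p. {p}) ` ones A"
  have "ones A \<subseteq> {..<dim_row A} \<times> {..<dim_col A}"
    by (auto simp: ones_def)
  then have "finite (ones A)"
    by (rule finite_subset) simp
  moreover have "partition_on (ones A) ?S"
    by (rule partition_onI) (auto simp: disjnt_def)
  moreover have "\<exists>I J. R = I \<times> J" if "R \<in> ?S" for R
  proof -
    from that obtain a b where "R = {(a, b)}" by auto
    then have "R = {a} \<times> {b}" by simp
    then show ?thesis by blast
  qed
  ultimately have "\<exists>P. finite P \<and> rectangle_partition A P \<and> card P = card ?S"
    unfolding rectangle_partition_def by (intro exI[of _ ?S]) simp
  then have "\<exists>r P. finite P \<and> rectangle_partition A P \<and> card P = r"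
    by blast
  then show ?thesis
    unfolding rank_bin_def by (rule LeastI_ex)
qed

end

theory Submission
  imports Defs "Jordan_Normal_Form.Matrix_Kernel"
begin

text \<open>
  Write \<open>M = J - N\<close> with \<open>N\<close> circulant block diagonal, and let \<open>u\<close> be the vector that equals
  \<open>1 / k\<^sub>i\<close> on the \<open>i\<close>th block. Then \<open>N u = 1\<close> and \<open>N\<^sup>T u = 1\<close>; put \<open>s = \<Sum> u = \<Sum> n\<^sub>i / k\<^sub>i\<close>.
  As \<open>s \<noteq> 1\<close>, the matrices \<open>M\<close> and \<open>N\<close> have the same column space.
  If the ones of \<open>M\<close> were partitioned into \<open>q \<le> rank M\<close> rectangles with indicator vectors
  \<open>a\<^sub>j, b\<^sub>j\<close>, then \<open>M = A B\<close> would be a full-rank factorization, so every \<open>a\<^sub>j\<close> lies in the column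
  space of \<open>N\<close>. As \<open>k\<^sub>i\<close> divides \<open>n\<^sub>i\<close>, even \<open>a\<^sub>j = N y\<close> with \<open>y\<close> integral. The vector
  \<open>z = (u \<bullet> a\<^sub>j) / (s - 1) u - y\<close> satisfies \<open>M z = a\<^sub>j\<close>, hence \<open>b\<^sub>j \<bullet> z = 1\<close>, that is,
  \<open>(u \<bullet> a\<^sub>j) (u \<bullet> b\<^sub>j) = (s - 1) (1 + b\<^sub>j \<bullet> y)\<close>. The left side is positive and
  \<open>b\<^sub>j \<bullet> y\<close> is an integer, so the left side is at least \<open>s - 1\<close>. Summing over \<open>j\<close> gives
  \<open>q (s - 1) \<le> u \<bullet> M u = s (s - 1)\<close>, so \<open>q \<le> s\<close>. But a kernel vector of a block is \<open>k\<^sub>i\<close>-periodic with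
  period sum zero, so the rank of \<open>M\<close> is at least \<open>\<Sum> (n\<^sub>i - k\<^sub>i + 1)\<close>, which exceeds \<open>s\<close> as soon as
  \<open>n\<^sub>i > k\<^sub>i > 1\<close> for some \<open>i\<close>.
\<close>

section \<open>Rank and kernel of matrices\<close>

lemma (in vectorspace) subspace_eq_carrier:
  assumes X: "subspace K X V" and fin: "fin_dim" "vectorspace.fin_dim K (vs X)"
    and dim: "dim \<le> vectorspace.dim K (vs X)"
  shows "X = carrier V"
proof -
  interpret X: vectorspace K "vs X" using X by (rule subspace_is_vs)
  have submodule_X: "submodule K X V" and X_subset: "X \<subseteq> carrier V"
    using X by (auto simp: subspace_def submodule_def)
  obtain b where b: "finite b" "X.basis b" using X.finite_basis_exists[OF fin(2)] by blast
  then have b_subset: "b \<subseteq> X" by (simp add: X.basis_def)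
  have "lin_indpt b" and "X = span b"
    using b(2) span_li_not_depend[OF b_subset submodule_X] by (auto simp: X.basis_def)
  moreover have "dim \<le> card b" using dim X.dim_basis[OF b] by simp
  ultimately have "basis b" using dim_li_is_basis[OF fin(1) b(1)] b_subset X_subset by blast
  then show ?thesis using \<open>X = span b\<close> by (simp add: basis_def)
qed

context vec_space
begin

lemma rank_eq_dim_col_space: "rank A = vectorspace.dim class_ring (vs (col_space A))"
  by (simp add: rank_def col_space_def)

lemma col_space_subspace: "A \<in> carrier_mat n nc \<Longrightarrow> subspace class_ring (col_space A) V"
  unfolding col_space_def by (metis cols_dim carrier_matD(1) span_is_subspace)

lemma fin_dim_col_space:
  "A \<in> carrier_mat n nc \<Longrightarrow> vectorspace.fin_dim class_ring (vs (col_space A))"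
  unfolding col_space_def by (rule fin_dim_span_cols)

lemma mem_col_space_iff:
  "A \<in> carrier_mat n nc \<Longrightarrow> y \<in> col_space A \<longleftrightarrow> (\<exists>x\<in>carrier_vec nc. A *\<^sub>v x = y)"
  by (auto simp: col_space_eq)

lemma col_space_mult_subset:
  assumes "A \<in> carrier_mat n k" "B \<in> carrier_mat k c"
  shows "col_space (A * B) \<subseteq> col_space A"
  using assms by (fastforce simp: mem_col_space_iff[of _ k] mem_col_space_iff[of _ c])

lemma nested_col_space_subspace:
  assumes A: "A \<in> carrier_mat n c" and B: "B \<in> carrier_mat n c'"
    and sub: "col_space A \<subseteq> col_space B"
  shows "subspace class_ring (col_space A) (vs (col_space B))"
  using nested_subspaces[OF col_space_subspace[OF B] col_space_subspace[OF A] sub] .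

lemma rank_mono_col_space:
  assumes A: "A \<in> carrier_mat n c" and B: "B \<in> carrier_mat n c'"
    and sub: "col_space A \<subseteq> col_space B"
  shows "rank A \<le> rank B"
proof -
  interpret B: vectorspace class_ring "vs (col_space B)"
    using col_space_subspace[OF B] by (rule subspace_is_vs)
  show ?thesis
    using B.subspace_dim[OF nested_col_space_subspace[OF A B sub] fin_dim_col_space[OF B]]
      fin_dim_col_space[OF A] by (simp add: rank_eq_dim_col_space)
qed

lemma col_space_eqI_rank:
  assumes A: "A \<in> carrier_mat n c" and B: "B \<in> carrier_mat n c'"
    and sub: "col_space A \<subseteq> col_space B" and rank: "rank B \<le> rank A"
  shows "col_space A = col_space B"
proof -
  interpret B: vectorspace class_ring "vs (col_space B)"
    using col_space_subspace[OF B] by (rule subspace_is_vs)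
  show ?thesis
    using B.subspace_eq_carrier[OF nested_col_space_subspace[OF A B sub] fin_dim_col_space[OF B]]
      fin_dim_col_space[OF A] rank by (simp add: rank_eq_dim_col_space)
qed

lemma rank_mult_le:
  assumes "A \<in> carrier_mat n k" "B \<in> carrier_mat k c"
  shows "rank (A * B) \<le> rank A"
  using assms by (intro rank_mono_col_space[OF _ _ col_space_mult_subset]) auto

end

lemma zero_in_mat_kernel: "A \<in> carrier_mat r c \<Longrightarrow> 0\<^sub>v c \<in> mat_kernel A"
  by (rule mat_kernelI) auto

lemma kernel_dim_eq_0_iff:
  fixes A :: "'a::field mat"
  assumes A: "A \<in> carrier_mat r c"
  shows "kernel_dim A = 0 \<longleftrightarrow> mat_kernel A = {0\<^sub>v c}"
proof -
  interpret kernel r c A by (rule kernel.intro) (rule A)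
  obtain b where b: "finite b" "basis b" using kernel_basis_exists[OF A] by blast
  have "b \<subseteq> mat_kernel A" and "0\<^sub>v c \<notin> b"
    using b(2) Ker.vs_zero_lin_dep by (auto simp: Ker.basis_def)
  then have "b = {} \<longleftrightarrow> mat_kernel A = {0\<^sub>v c}"
    using b(2) zero_in_mat_kernel[OF A] by (auto simp: Ker.basis_def Ker.span_empty)
  then show ?thesis using Ker.dim_basis[OF b] b(1) by simp
qed

lemma rank_nullity_mat:
  fixes A :: "'a::field mat"
  assumes A: "A \<in> carrier_mat r c"
  shows "vec_space.rank r A + kernel_dim A = c"
proof -
  interpret kernel r c A by (rule kernel.intro) (rule A)
  interpret R: vec_space "TYPE('a)" r .
  have "mod_hom class_ring NC.V R.V ((*\<^sub>v) A)"
    using A by unfold_locales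
      (auto simp: LinearCombinations.module_hom_def module_vec_simps
        mult_add_distrib_mat_vec[OF A] mult_mat_vec[OF A])
  then interpret T: linear_map class_ring NC.V R.V "(*\<^sub>v) A"
    by (simp add: linear_map_def NC.vectorspace_axioms R.vectorspace_axioms)
  have "T.imT = R.col_space A"
    using A by (auto simp: T.im_def R.mem_col_space_iff module_vec_simps)
  moreover have "T.kerT = mat_kernel A"
    using A by (auto simp: T.ker_def mat_kernel module_vec_simps)
  ultimately show ?thesis
    using T.rank_nullity A by (simp add: R.rank_eq_dim_col_space NC.dim_is_n)
qed

lemma full_rank_iff_trivial_kernel:
  fixes A :: "'a::field mat"
  assumes A: "A \<in> carrier_mat r c"
  shows "vec_space.rank r A = c \<longleftrightarrow> mat_kernel A = {0\<^sub>v c}"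
  using rank_nullity_mat[OF A] kernel_dim_eq_0_iff[OF A] by linarith

lemma mult_mat_unit_vec:
  fixes A :: "'a::semiring_1 mat"
  shows "A \<in> carrier_mat r c \<Longrightarrow> j < c \<Longrightarrow> A *\<^sub>v unit_vec c j = col A j"
  by (intro eq_vecI) auto

lemma mult_mat_vec_cancel:
  fixes A :: "'a::field mat"
  assumes A: "A \<in> carrier_mat r c" and kernel: "mat_kernel A = {0\<^sub>v c}"
    and x: "x \<in> carrier_vec c" and y: "y \<in> carrier_vec c" and eq: "A *\<^sub>v x = A *\<^sub>v y"
  shows "x = y"
proof -
  have "A *\<^sub>v (x - y) = 0\<^sub>v r"
    using A x y eq by (simp add: mult_minus_distrib_mat_vec[OF A])
  then have "x - y = 0\<^sub>v c"
    using mat_kernelI[OF A] kernel x y by (metis minus_carrier_vec singletonD)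
  then show ?thesis using x y by (auto simp: vec_eq_iff)
qed

lemma rank_ge_if_trivial_kernel_mult:
  fixes A :: "'a::field mat"
  assumes A: "A \<in> carrier_mat r c" and S: "S \<in> carrier_mat c k"
    and kernel: "mat_kernel (A * S) = {0\<^sub>v k}"
  shows "k \<le> vec_space.rank r A"
proof -
  have "vec_space.rank r (A * S) = k"
    using full_rank_iff_trivial_kernel[of "A * S" r k] A S kernel by simp
  then show ?thesis using vec_space.rank_mult_le[OF A S] by simp
qed

lemma rank_ge_if_kernel_initial_zeros:
  fixes A :: "'a::field mat"
  assumes A: "A \<in> carrier_mat r c" and p: "p \<le> c"
    and initial: "\<And>x. x \<in> mat_kernel A \<Longrightarrow> (\<And>i. i < p \<Longrightarrow> x $ i = 0) \<Longrightarrow> x = 0\<^sub>v c"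
  shows "c - p \<le> vec_space.rank r A"
proof -
  define S :: "'a mat" where "S = 0\<^sub>m p (c - p) @\<^sub>r 1\<^sub>m (c - p)"
  have S: "S \<in> carrier_mat c (c - p)"
    using carrier_append_rows[of "0\<^sub>m p (c - p)" p "c - p" "1\<^sub>m (c - p)" "c - p"] p
    by (simp add: S_def)
  have "0\<^sub>m p (c - p) *\<^sub>v w = 0\<^sub>v p" if "w \<in> carrier_vec (c - p)" for w :: "'a vec"
    using that by (intro eq_vecI) auto
  then have S_mult: "S *\<^sub>v w = 0\<^sub>v p @\<^sub>v w" if "w \<in> carrier_vec (c - p)" for w
    using mat_mult_append[OF zero_carrier_mat one_carrier_mat that, of p] that
    by (simp add: S_def)
  have "w = 0\<^sub>v (c - p)" if "w \<in> mat_kernel (A * S)" for w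
  proof -
    have w: "w \<in> carrier_vec (c - p)" and kernel: "A * S *\<^sub>v w = 0\<^sub>v r"
      using mat_kernelD[OF mult_carrier_mat[OF A S] that] by simp_all
    have "S *\<^sub>v w \<in> mat_kernel A"
      using kernel w S assoc_mult_mat_vec[OF A S w] by (intro mat_kernelI[OF A]) auto
    then have "0\<^sub>v p @\<^sub>v w = 0\<^sub>v c" using initial[of "S *\<^sub>v w"] S_mult[OF w] by simp
    also have "\<dots> = 0\<^sub>v p @\<^sub>v 0\<^sub>v (c - p)" using p by (intro eq_vecI) auto
    finally show ?thesis using append_vec_eq[of "0\<^sub>v p :: 'a vec" p "0\<^sub>v p"] by simp
  qed
  then have "mat_kernel (A * S) = {0\<^sub>v (c - p)}"
    using zero_in_mat_kernel[OF mult_carrier_mat[OF A S]] by blast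
  then show ?thesis by (rule rank_ge_if_trivial_kernel_mult[OF A S])
qed

abbreviation block_sum :: "'a::zero mat \<Rightarrow> 'a mat \<Rightarrow> 'a mat" where
  "block_sum A B \<equiv> four_block_mat A (0\<^sub>m (dim_row A) (dim_col B)) (0\<^sub>m (dim_row B) (dim_col A)) B"

lemma rank_block_sum:
  fixes A B :: "'a::field mat"
  assumes A: "A \<in> carrier_mat d d" and B: "B \<in> carrier_mat e e"
  shows "vec_space.rank (d + e) (block_sum A B) = vec_space.rank d A + vec_space.rank e B"
proof -
  have carrier: "block_sum A B \<in> carrier_mat (d + e) (d + e)" using A B by simp
  have "kernel_dim (block_sum A B) = kernel_dim A + kernel_dim B"
    using kernel_four_block_0_mat[OF refl A B] A B by (simp add: kernel_dim_def)
  then show ?thesis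
    using rank_nullity_mat[OF A] rank_nullity_mat[OF B] rank_nullity_mat[OF carrier] by linarith
qed

lemma rank_diag_block_mat:
  fixes As :: "'a::field mat list"
  assumes "\<And>A. A \<in> set As \<Longrightarrow> square_mat A"
  shows "vec_space.rank (dim_row (diag_block_mat As)) (diag_block_mat As) =
    (\<Sum>A\<leftarrow>As. vec_space.rank (dim_row A) A)"
  using assms
proof (induction As)
  case Nil
  show ?case by (simp add: vec_space.rank_0I)
next
  case (Cons A As)
  let ?B = "diag_block_mat As"
  have "square_mat A" "square_mat ?B"
    using Cons.prems diag_block_mat_square[of As] by (auto simp del: square_mat.simps)
  then have A: "A \<in> carrier_mat (dim_row A) (dim_row A)"
    and B: "?B \<in> carrier_mat (dim_row ?B) (dim_row ?B)"
    by auto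
  have "vec_space.rank (dim_row ?B) ?B = (\<Sum>A\<leftarrow>As. vec_space.rank (dim_row A) A)"
    using Cons by simp
  then show ?case
    using rank_block_sum[OF A B] carrier_matD(2)[OF A] carrier_matD(2)[OF B]
    by (simp add: Let_def)
qed

section \<open>Rectangle partitions as factorizations\<close>

lemma sum_of_bool_partition_on:
  assumes P: "partition_on A P" "finite P"
  shows "(\<Sum>R\<in>P. of_bool (x \<in> R)) = (of_bool (x \<in> A) :: 'a::semiring_1)"
proof (cases "x \<in> A")
  case True
  then obtain R where R: "R \<in> P" "x \<in> R" using P(1) by (auto simp: partition_on_def)
  have "x \<in> R' \<longleftrightarrow> R' = R" if "R' \<in> P" for R'
    using R that partition_onD2[OF P(1)] by (auto simp: disjoint_def)
  then have "(\<Sum>R'\<in>P. of_bool (x \<in> R')) = (\<Sum>R'\<in>P. of_bool (R' = R) :: 'a)"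
    by (intro sum.cong) auto
  then show ?thesis using R(1) P(2) True by (simp add: of_bool_def)
next
  case False
  then have "x \<notin> R" if "R \<in> P" for R using P(1) that by (auto simp: partition_on_def)
  then show ?thesis using False by simp
qed

lemma vec_set_row_subset: "i < dim_row A \<Longrightarrow> set\<^sub>v (row A i) \<subseteq> elements_mat A"
  by (auto elim!: vec_setE)

lemma vec_set_col_subset: "j < dim_col A \<Longrightarrow> set\<^sub>v (col A j) \<subseteq> elements_mat A"
  by (auto elim!: vec_setE)

lemma rectangle_partition_mem_iff:
  assumes "rectangle_partition M P" "R \<in> P"
  shows "(i, l) \<in> R \<longleftrightarrow> i \<in> Domain R \<and> l \<in> Range R"
  using assms by (fastforce simp: rectangle_partition_def)

lemma rectangle_partition_nonempty:
  assumes "rectangle_partition M P" "R \<in> P"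
  shows "\<exists>i<dim_row M. \<exists>l<dim_col M. i \<in> Domain R \<and> l \<in> Range R"
proof -
  have "R \<noteq> {}" "R \<subseteq> ones M"
    using assms partition_onD3 by (auto simp: rectangle_partition_def partition_on_def)
  then show ?thesis by (fastforce simp: ones_def)
qed

lemma sum_of_bool_rectangle_partition:
  assumes P: "rectangle_partition M P" "finite P" and binary: "elements_mat M \<subseteq> {0, 1}"
    and bounds: "i < dim_row M" "l < dim_col M"
  shows "(\<Sum>R\<in>P. of_bool ((i, l) \<in> R)) = M $$ (i, l)"
proof -
  have "M $$ (i, l) \<in> {0, 1}" using binary bounds by blast
  then have "M $$ (i, l) = of_bool ((i, l) \<in> ones M)" using bounds by (auto simp: ones_def)
  moreover have "partition_on (ones M) P" using P(1) by (simp add: rectangle_partition_def)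
  ultimately show ?thesis using sum_of_bool_partition_on[OF _ P(2)] by metis
qed

lemma rank_bin_factorization:
  assumes M: "M \<in> carrier_mat r c" and binary: "elements_mat M \<subseteq> {0, 1}"
  obtains A B where "A \<in> carrier_mat r (rank_bin M)" "B \<in> carrier_mat (rank_bin M) c" "M = A * B"
    "elements_mat A \<subseteq> {0, 1}" "elements_mat B \<subseteq> {0, 1}"
    "\<And>j. j < rank_bin M \<Longrightarrow> col A j \<noteq> 0\<^sub>v r" "\<And>j. j < rank_bin M \<Longrightarrow> row B j \<noteq> 0\<^sub>v c"
proof -
  define q where "q = rank_bin M"
  obtain P where P: "finite P" "rectangle_partition M P" "card P = q"
    using rank_bin_attained unfolding q_def by blast
  obtain R where R: "bij_betw R {0..<q} P" using ex_bij_betw_nat_finite[OF P(1)] P(3) by auto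
  then have R_mem: "R j \<in> P" if "j < q" for j using that by (auto simp: bij_betw_def)
  define A :: "real mat" where "A = mat r q (\<lambda>(i, j). of_bool (i \<in> Domain (R j)))"
  define B :: "real mat" where "B = mat q c (\<lambda>(j, l). of_bool (l \<in> Range (R j)))"
  show thesis
  proof (rule that[folded q_def])
    show A: "A \<in> carrier_mat r q" and B: "B \<in> carrier_mat q c" by (simp_all add: A_def B_def)
    show "elements_mat A \<subseteq> {0, 1}" "elements_mat B \<subseteq> {0, 1}" by (auto simp: A_def B_def)
    show "col A j \<noteq> 0\<^sub>v r" "row B j \<noteq> 0\<^sub>v c" if "j < q" for j
      using rectangle_partition_nonempty[OF P(2) R_mem[OF that]] M that
      by (auto simp: A_def B_def vec_eq_iff)
    show "M = A * B"
    proof (rule eq_matI)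
      fix i l assume "i < dim_row (A * B)" "l < dim_col (A * B)"
      then have bounds: "i < r" "l < c" using A B by auto
      then have "(A * B) $$ (i, l) = (\<Sum>j = 0..<q. of_bool ((i, l) \<in> R j))"
        using A B rectangle_partition_mem_iff[OF P(2) R_mem]
        by (simp add: A_def B_def scalar_prod_def of_bool_conj)
      also have "\<dots> = (\<Sum>S\<in>P. of_bool ((i, l) \<in> S))" by (rule sum.reindex_bij_betw[OF R])
      also have "\<dots> = M $$ (i, l)"
        using sum_of_bool_rectangle_partition[OF P(2,1) binary] bounds M by simp
      finally show "M $$ (i, l) = (A * B) $$ (i, l)" by simp
    qed (use M A B in auto)
  qed
qed

section \<open>Complements of balanced matrices\<close>

abbreviation ones_vec :: "nat \<Rightarrow> real vec" where
  "ones_vec d \<equiv> vec d (\<lambda>_. 1)"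

abbreviation integral_vec :: "real vec \<Rightarrow> bool" where
  "integral_vec v \<equiv> set\<^sub>v v \<subseteq> \<int>"

definition integral_preimages :: "real mat \<Rightarrow> bool" where
  "integral_preimages N \<longleftrightarrow> (\<forall>x\<in>carrier_vec (dim_col N). integral_vec (N *\<^sub>v x) \<longrightarrow>
     (\<exists>y\<in>carrier_vec (dim_col N). integral_vec y \<and> N *\<^sub>v y = N *\<^sub>v x))"

lemma scalar_prod_in_Ints:
  assumes "v \<in> carrier_vec d" "w \<in> carrier_vec d" "integral_vec v" "integral_vec w"
  shows "v \<bullet> w \<in> \<int>"
  unfolding scalar_prod_def using assms by (intro Ints_sum Ints_mult) (auto simp: vec_set_def)

lemma scalar_prod_pos:
  fixes v w :: "'a::linordered_semidom vec"
  assumes "v \<in> carrier_vec d" "w \<in> carrier_vec d" and "\<And>i. i < d \<Longrightarrow> 0 < v $ i"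
    and "\<And>i. i < d \<Longrightarrow> 0 \<le> w $ i" and "w \<noteq> 0\<^sub>v d"
  shows "0 < v \<bullet> w"
proof -
  obtain p where p: "p < d" "w $ p \<noteq> 0"
    using assms(2,5) by (auto simp: vec_eq_iff)
  have "0 < (\<Sum>i = 0..<d. v $ i * w $ i)"
    by (rule sum_pos2[of _ p]) (use p assms(3,4) in \<open>force simp: less_le\<close>)+
  then show ?thesis using assms(2) by (simp add: scalar_prod_def)
qed

lemma sum_col_row_scalar_prod:
  fixes A B :: "'a::comm_ring_1 mat"
  assumes A: "A \<in> carrier_mat r q" and B: "B \<in> carrier_mat q c"
    and v: "v \<in> carrier_vec r" and w: "w \<in> carrier_vec c"
  shows "(\<Sum>j<q. (v \<bullet> col A j) * (w \<bullet> row B j)) = v \<bullet> (A * B *\<^sub>v w)"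
proof -
  have "v \<bullet> (A * B *\<^sub>v w) = (transpose_mat A *\<^sub>v v) \<bullet> (B *\<^sub>v w)"
    using transpose_vec_mult_scalar[OF A _ v, of "B *\<^sub>v w"] A B w by simp
  also have "\<dots> = (\<Sum>j<q. (v \<bullet> col A j) * (w \<bullet> row B j))"
    using A B v w by (simp add: scalar_prod_def[of _ "B *\<^sub>v w"] atLeast0LessThan
      comm_scalar_prod[of v r] comm_scalar_prod[of w c])
  finally show ?thesis by simp
qed

lemma complement_mat_carrier: "N \<in> carrier_mat r c \<Longrightarrow> complement_mat N \<in> carrier_mat r c"
  by (simp add: complement_mat_def)

lemma complement_mult_vec:
  assumes "N \<in> carrier_mat r c" "x \<in> carrier_vec c"
  shows "complement_mat N *\<^sub>v x = (ones_vec c \<bullet> x) \<cdot>\<^sub>v ones_vec r - N *\<^sub>v x"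
  using assms by (intro eq_vecI)
    (auto simp: complement_mat_def scalar_prod_def left_diff_distrib sum_subtractf)

locale balanced_mat =
  fixes d :: nat and N :: "real mat" and u :: "real vec"
  assumes N_carrier: "N \<in> carrier_mat d d" and u_carrier: "u \<in> carrier_vec d"
    and u_pos: "i < d \<Longrightarrow> 0 < u $ i"
    and mult_u: "N *\<^sub>v u = ones_vec d" and transpose_mult_u: "transpose_mat N *\<^sub>v u = ones_vec d"
begin

abbreviation weight :: real where "weight \<equiv> ones_vec d \<bullet> u"

lemmas complement_carrier = complement_mat_carrier[OF N_carrier]

lemma scalar_prod_mult: "x \<in> carrier_vec d \<Longrightarrow> u \<bullet> (N *\<^sub>v x) = ones_vec d \<bullet> x"
  using transpose_vec_mult_scalar[OF N_carrier _ u_carrier] transpose_mult_u by simp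

lemma mult_smult_u_minus:
  "x \<in> carrier_vec d \<Longrightarrow> N *\<^sub>v (c \<cdot>\<^sub>v u - x) = c \<cdot>\<^sub>v ones_vec d - N *\<^sub>v x"
  using N_carrier u_carrier mult_u
  by (simp add: mult_minus_distrib_mat_vec[OF N_carrier] mult_mat_vec[OF N_carrier])

lemma complement_mult_eq:
  "x \<in> carrier_vec d \<Longrightarrow> complement_mat N *\<^sub>v x = N *\<^sub>v ((ones_vec d \<bullet> x) \<cdot>\<^sub>v u - x)"
  by (simp add: complement_mult_vec[OF N_carrier] mult_smult_u_minus)

lemma complement_mult_u: "complement_mat N *\<^sub>v u = (weight - 1) \<cdot>\<^sub>v ones_vec d"
  using u_carrier mult_u by (auto simp: complement_mult_vec[OF N_carrier])

lemma complement_mult_preimage: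
  assumes weight: "weight \<noteq> 1" and y: "y \<in> carrier_vec d"
  shows "complement_mat N *\<^sub>v ((u \<bullet> (N *\<^sub>v y) / (weight - 1)) \<cdot>\<^sub>v u - y) = N *\<^sub>v y"
proof -
  define c where "c = u \<bullet> (N *\<^sub>v y) / (weight - 1)"
  have z: "c \<cdot>\<^sub>v u - y \<in> carrier_vec d" using u_carrier y by simp
  have "ones_vec d \<bullet> (c \<cdot>\<^sub>v u - y) = c * weight - u \<bullet> (N *\<^sub>v y)"
    using u_carrier y by (simp add: scalar_prod_mult scalar_prod_minus_distrib[of _ d])
  also have "\<dots> = c" using weight by (simp add: c_def field_simps)
  finally have "complement_mat N *\<^sub>v (c \<cdot>\<^sub>v u - y) = N *\<^sub>v (c \<cdot>\<^sub>v u - (c \<cdot>\<^sub>v u - y))"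
    using complement_mult_eq[OF z] by simp
  also have "c \<cdot>\<^sub>v u - (c \<cdot>\<^sub>v u - y) = y" using u_carrier y by (intro eq_vecI) auto
  finally show ?thesis by (simp add: c_def)
qed

lemma col_space_complement:
  assumes "weight \<noteq> 1"
  shows "vec_space.col_space d (complement_mat N) = vec_space.col_space d N"
proof -
  interpret vec_space "TYPE(real)" d .
  show ?thesis
  proof (intro equalityI subsetI)
    fix y assume "y \<in> col_space (complement_mat N)"
    then obtain x where "x \<in> carrier_vec d" "complement_mat N *\<^sub>v x = y"
      using mem_col_space_iff[OF complement_carrier] by blast
    moreover from this have "(ones_vec d \<bullet> x) \<cdot>\<^sub>v u - x \<in> carrier_vec d" using u_carrier by simp
    ultimately show "y \<in> col_space N"
      using complement_mult_eq mem_col_space_iff[OF N_carrier] by metis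
  next
    fix y assume "y \<in> col_space N"
    then obtain x where x: "x \<in> carrier_vec d" "N *\<^sub>v x = y"
      using mem_col_space_iff[OF N_carrier] by blast
    then have "(u \<bullet> y / (weight - 1)) \<cdot>\<^sub>v u - x \<in> carrier_vec d" using u_carrier by simp
    then show "y \<in> col_space (complement_mat N)"
      using complement_mult_preimage[OF assms x(1)] x(2) mem_col_space_iff[OF complement_carrier]
      by blast
  qed
qed

lemma rank_complement: "weight \<noteq> 1 \<Longrightarrow> vec_space.rank d (complement_mat N) = vec_space.rank d N"
  by (simp add: vec_space.rank_eq_dim_col_space col_space_complement)

lemma weight_minus_1_le_product:
  assumes weight: "1 < weight" and y: "y \<in> carrier_vec d" "integral_vec y"
    and b: "b \<in> carrier_vec d" "integral_vec b" "0 < u \<bullet> b" and a: "0 < u \<bullet> (N *\<^sub>v y)"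
    and z: "b \<bullet> ((u \<bullet> (N *\<^sub>v y) / (weight - 1)) \<cdot>\<^sub>v u - y) = 1"
  shows "weight - 1 \<le> (u \<bullet> (N *\<^sub>v y)) * (u \<bullet> b)"
proof -
  have "u \<bullet> (N *\<^sub>v y) / (weight - 1) * (u \<bullet> b) - b \<bullet> y = 1"
    using z u_carrier y(1) b(1)
    by (simp add: scalar_prod_minus_distrib[of _ d] comm_scalar_prod[of u d b])
  then have product: "(u \<bullet> (N *\<^sub>v y)) * (u \<bullet> b) = (weight - 1) * (1 + b \<bullet> y)"
    using weight by (simp add: field_simps)
  moreover have "0 < (u \<bullet> (N *\<^sub>v y)) * (u \<bullet> b)" using a b(3) by simp
  ultimately have "0 < 1 + b \<bullet> y" using weight by (simp add: zero_less_mult_iff)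
  moreover have "b \<bullet> y \<in> \<int>" using b y by (intro scalar_prod_in_Ints)
  ultimately have "1 \<le> 1 + b \<bullet> y" by (auto elim!: Ints_cases)
  then show ?thesis using product weight by (simp add: mult_le_cancel_left1)
qed

lemma right_factor_mult_preimage:
  assumes weight: "weight \<noteq> 1" and A: "A \<in> carrier_mat d q" "mat_kernel A = {0\<^sub>v q}"
    and B: "B \<in> carrier_mat q d" and factors: "complement_mat N = A * B" and j: "j < q"
    and y: "y \<in> carrier_vec d" "N *\<^sub>v y = col A j"
  shows "B *\<^sub>v ((u \<bullet> (N *\<^sub>v y) / (weight - 1)) \<cdot>\<^sub>v u - y) = unit_vec q j"
proof (rule mult_mat_vec_cancel[OF A])
  let ?z = "(u \<bullet> (N *\<^sub>v y) / (weight - 1)) \<cdot>\<^sub>v u - y"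
  have z: "?z \<in> carrier_vec d" using u_carrier y(1) by simp
  then show "B *\<^sub>v ?z \<in> carrier_vec q" using B by simp
  have "A *\<^sub>v (B *\<^sub>v ?z) = complement_mat N *\<^sub>v ?z" using A(1) B z factors by simp
  also have "\<dots> = col A j" using complement_mult_preimage[OF weight y(1)] y(2) by simp
  also have "\<dots> = A *\<^sub>v unit_vec q j" using A(1) j by (simp add: mult_mat_unit_vec)
  finally show "A *\<^sub>v (B *\<^sub>v ?z) = A *\<^sub>v unit_vec q j" .
qed simp

lemma rectangle_weight_ge:
  assumes weight: "1 < weight" and preimages: "integral_preimages N"
    and A: "A \<in> carrier_mat d q" "elements_mat A \<subseteq> {0, 1}" "mat_kernel A = {0\<^sub>v q}"
    and B: "B \<in> carrier_mat q d" "elements_mat B \<subseteq> {0, 1}"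
    and factors: "complement_mat N = A * B" and j: "j < q"
    and nonzero: "col A j \<noteq> 0\<^sub>v d" "row B j \<noteq> 0\<^sub>v d"
    and col: "col A j \<in> vec_space.col_space d N"
  shows "weight - 1 \<le> (u \<bullet> col A j) * (u \<bullet> row B j)"
proof -
  have binary: "set\<^sub>v (col A j) \<subseteq> {0, 1}" "set\<^sub>v (row B j) \<subseteq> {0, 1}"
    using vec_set_col_subset[of j A] vec_set_row_subset[of j B] A B j by auto
  then have integral: "integral_vec (col A j)" "integral_vec (row B j)" by auto
  have positive: "0 < u \<bullet> col A j" "0 < u \<bullet> row B j"
    using binary nonzero A B j u_carrier u_pos
    by (auto simp: vec_set_def intro!: scalar_prod_pos[of u d])
  obtain x where "x \<in> carrier_vec d" "N *\<^sub>v x = col A j"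
    using col vec_space.mem_col_space_iff[OF N_carrier] by blast
  then obtain y where y: "y \<in> carrier_vec d" "integral_vec y" "N *\<^sub>v y = col A j"
    using preimages integral(1) N_carrier unfolding integral_preimages_def
    by (metis carrier_matD(2))
  define z where "z = (u \<bullet> (N *\<^sub>v y) / (weight - 1)) \<cdot>\<^sub>v u - y"
  have "row B j \<bullet> z = (B *\<^sub>v z) $ j" using j B(1) by simp
  also have "\<dots> = 1"
    using right_factor_mult_preimage[OF _ A(1,3) B(1) factors j y(1,3)] weight j
    by (simp add: z_def)
  finally show ?thesis
    using weight_minus_1_le_product[OF weight y(1,2), of "row B j"] integral(2) positive B(1) j y(3)
    by (simp add: z_def)
qed

lemma inner_dim_le_weight:
  assumes weight: "1 < weight" and preimages: "integral_preimages N"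
    and A: "A \<in> carrier_mat d q" "elements_mat A \<subseteq> {0, 1}" "\<And>j. j < q \<Longrightarrow> col A j \<noteq> 0\<^sub>v d"
    and B: "B \<in> carrier_mat q d" "elements_mat B \<subseteq> {0, 1}" "\<And>j. j < q \<Longrightarrow> row B j \<noteq> 0\<^sub>v d"
    and factors: "complement_mat N = A * B" and rank: "q \<le> vec_space.rank d (complement_mat N)"
  shows "q \<le> weight"
proof -
  interpret vec_space "TYPE(real)" d .
  have rank_A: "rank A = q"
    using rank rank_mult_le[OF A(1) B(1)] rank_le_nc[OF A(1)] factors by simp
  then have kernel_A: "mat_kernel A = {0\<^sub>v q}" using full_rank_iff_trivial_kernel[OF A(1)] by simp
  have "col_space A = col_space N"
    using col_space_eqI_rank[OF complement_carrier A(1)] col_space_mult_subset[OF A(1) B(1)]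
      col_space_complement rank rank_A weight factors by simp
  then have "col A j \<in> col_space N" if "j < q" for j
    using mem_col_space_iff[OF A(1)] mult_mat_unit_vec[OF A(1) that] unit_vec_carrier by blast
  then have "weight - 1 \<le> (u \<bullet> col A j) * (u \<bullet> row B j)" if "j < q" for j
    using rectangle_weight_ge[OF weight preimages A(1,2) kernel_A B(1,2) factors that]
      A(3) B(3) that by blast
  then have "q * (weight - 1) \<le> (\<Sum>j<q. (u \<bullet> col A j) * (u \<bullet> row B j))"
    using sum_bounded_below[of "{..<q}" "weight - 1"] by simp
  also have "\<dots> = u \<bullet> (complement_mat N *\<^sub>v u)"
    using sum_col_row_scalar_prod[OF A(1) B(1) u_carrier u_carrier] factors by simp
  also have "\<dots> = weight * (weight - 1)"
    using u_carrier by (simp add: complement_mult_u comm_scalar_prod[of u d])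
  finally show ?thesis using weight by simp
qed

theorem rank_complement_less_rank_bin:
  assumes weight: "1 < weight" "weight < vec_space.rank d N"
    and preimages: "integral_preimages N" and binary: "elements_mat N \<subseteq> {0, 1}"
  shows "vec_space.rank d (complement_mat N) < rank_bin (complement_mat N)"
proof (rule ccontr)
  let ?M = "complement_mat N"
  assume "\<not> vec_space.rank d ?M < rank_bin ?M"
  then have rank_bin_le: "rank_bin ?M \<le> vec_space.rank d ?M" by simp
  have "elements_mat ?M \<subseteq> {0, 1}" using binary by (auto simp: complement_mat_def)
  then obtain A B where A: "A \<in> carrier_mat d (rank_bin ?M)"
    and B: "B \<in> carrier_mat (rank_bin ?M) d"
    and factors: "?M = A * B" and "elements_mat A \<subseteq> {0, 1}" "elements_mat B \<subseteq> {0, 1}"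
      "\<And>j. j < rank_bin ?M \<Longrightarrow> col A j \<noteq> 0\<^sub>v d" "\<And>j. j < rank_bin ?M \<Longrightarrow> row B j \<noteq> 0\<^sub>v d"
    using rank_bin_factorization[OF complement_carrier] by metis
  then have "rank_bin ?M \<le> weight"
    using inner_dim_le_weight[OF weight(1) preimages] rank_bin_le by blast
  also have "weight < vec_space.rank d ?M" using weight by (simp add: rank_complement)
  also have "vec_space.rank d ?M \<le> rank_bin ?M"
    using vec_space.rank_mult_le[OF A B] vec_space.rank_le_nc[OF A] factors by simp
  finally show False by simp
qed

end

section \<open>Block sums\<close>

lemma block_sum_mult_vec:
  assumes "A \<in> carrier_mat d d" "B \<in> carrier_mat e e" "x \<in> carrier_vec d" "y \<in> carrier_vec e"
  shows "block_sum A B *\<^sub>v (x @\<^sub>v y) = (A *\<^sub>v x) @\<^sub>v (B *\<^sub>v y)"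
  using mult_mat_vec_split[OF assms] assms by auto

lemma ones_vec_append: "ones_vec d @\<^sub>v ones_vec e = ones_vec (d + e)"
  by (intro eq_vecI) auto

lemma vec_set_append: "set\<^sub>v (v @\<^sub>v w) = set\<^sub>v v \<union> set\<^sub>v w"
proof (intro equalityI subsetI)
  fix a assume "a \<in> set\<^sub>v v \<union> set\<^sub>v w"
  then consider i where "i < dim_vec v" "a = v $ i" | i where "i < dim_vec w" "a = w $ i"
    by (auto elim!: vec_setE)
  then show "a \<in> set\<^sub>v (v @\<^sub>v w)"
  proof cases
    case 1
    then show ?thesis by (intro vec_setI[of _ i]) auto
  next
    case 2
    then show ?thesis by (intro vec_setI[of _ "dim_vec v + i"]) auto
  qed
qed (auto simp: vec_set_def split: if_splits)

lemma balanced_mat_block_sum: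
  assumes "balanced_mat d A u" "balanced_mat e B v"
  shows "balanced_mat (d + e) (block_sum A B) (u @\<^sub>v v)"
proof -
  interpret A: balanced_mat d A u by fact
  interpret B: balanced_mat e B v by fact
  note A = A.N_carrier and B = B.N_carrier and u = A.u_carrier and v = B.u_carrier
  have "transpose_mat (block_sum A B) = block_sum (transpose_mat A) (transpose_mat B)"
    using A B by (subst transpose_four_block_mat) auto
  then show ?thesis
    using A B u v A.u_pos B.u_pos block_sum_mult_vec[OF A B u v]
      block_sum_mult_vec[of "transpose_mat A" d "transpose_mat B" e, OF _ _ u v]
    by unfold_locales
      (auto simp: A.mult_u B.mult_u A.transpose_mult_u B.transpose_mult_u ones_vec_append)
qed

lemma balanced_mat_diag_block_mat:
  assumes "\<And>i. i \<in> set js \<Longrightarrow> balanced_mat (d i) (N i) (u i)"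
  shows "\<exists>v. balanced_mat (\<Sum>i\<leftarrow>js. d i) (diag_block_mat (map N js)) v \<and>
    ones_vec (\<Sum>i\<leftarrow>js. d i) \<bullet> v = (\<Sum>i\<leftarrow>js. ones_vec (d i) \<bullet> u i)"
  using assms
proof (induction js)
  case Nil
  have "balanced_mat 0 (0\<^sub>m 0 0) (0\<^sub>v 0)" by unfold_locales auto
  then show ?case by (auto simp: scalar_prod_def)
next
  case (Cons i js)
  let ?d = "\<Sum>i\<leftarrow>js. d i"
  obtain v where v: "balanced_mat ?d (diag_block_mat (map N js)) v"
      "ones_vec ?d \<bullet> v = (\<Sum>i\<leftarrow>js. ones_vec (d i) \<bullet> u i)"
    using Cons by auto
  have head: "balanced_mat (d i) (N i) (u i)" using Cons.prems by simp
  have "balanced_mat (d i + ?d) (diag_block_mat (map N (i # js))) (u i @\<^sub>v v)"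
    using balanced_mat_block_sum[OF head v(1)] by (simp add: Let_def)
  moreover have "ones_vec (d i + ?d) \<bullet> (u i @\<^sub>v v) = ones_vec (d i) \<bullet> u i + ones_vec ?d \<bullet> v"
    using balanced_mat.u_carrier[OF head] balanced_mat.u_carrier[OF v(1)]
    by (simp add: ones_vec_append[symmetric] scalar_prod_append[of _ "d i" _ ?d])
  ultimately show ?case using v(2) by auto
qed

lemma integral_preimages_block_sum:
  assumes A: "A \<in> carrier_mat d d" "integral_preimages A"
    and B: "B \<in> carrier_mat e e" "integral_preimages B"
  shows "integral_preimages (block_sum A B)"
proof -
  have "\<exists>y\<in>carrier_vec (d + e). integral_vec y \<and>
      block_sum A B *\<^sub>v y = block_sum A B *\<^sub>v (x1 @\<^sub>v x2)"
    if x: "x1 \<in> carrier_vec d" "x2 \<in> carrier_vec e"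
      and integral: "integral_vec (block_sum A B *\<^sub>v (x1 @\<^sub>v x2))" for x1 x2
  proof -
    have "integral_vec (A *\<^sub>v x1)" "integral_vec (B *\<^sub>v x2)"
      using integral by (simp_all add: block_sum_mult_vec[OF A(1) B(1) x] vec_set_append)
    then obtain y1 y2 where y: "y1 \<in> carrier_vec d" "integral_vec y1" "A *\<^sub>v y1 = A *\<^sub>v x1"
        "y2 \<in> carrier_vec e" "integral_vec y2" "B *\<^sub>v y2 = B *\<^sub>v x2"
      using A B x unfolding integral_preimages_def by (metis carrier_matD(2))
    then have "block_sum A B *\<^sub>v (y1 @\<^sub>v y2) = block_sum A B *\<^sub>v (x1 @\<^sub>v x2)"
      using x by (simp add: block_sum_mult_vec[OF A(1) B(1)])
    then show ?thesis using y by (intro bexI[of _ "y1 @\<^sub>v y2"]) (auto simp: vec_set_append)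
  qed
  then show ?thesis using A(1) B(1) by (simp add: integral_preimages_def all_vec_append)
qed

lemma integral_preimages_diag_block_mat:
  assumes "\<And>A. A \<in> set As \<Longrightarrow> square_mat A \<and> integral_preimages A"
  shows "integral_preimages (diag_block_mat As)"
  using assms
proof (induction As)
  case Nil
  show ?case by (auto simp: integral_preimages_def vec_set_def)
next
  case (Cons A As)
  let ?B = "diag_block_mat As"
  have "square_mat A" "square_mat ?B"
    using Cons.prems diag_block_mat_square[of As] by (auto simp del: square_mat.simps)
  then have "A \<in> carrier_mat (dim_row A) (dim_row A)" "?B \<in> carrier_mat (dim_row ?B) (dim_row ?B)"
    by auto
  then have "integral_preimages (block_sum A ?B)"
    using Cons by (intro integral_preimages_block_sum) auto
  then show ?case by (simp add: Let_def)
qed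

section \<open>Window sums\<close>

lemma sum_window_Suc:
  fixes f :: "nat \<Rightarrow> 'a::comm_monoid_add"
  shows "(\<Sum>l<k. f (Suc i + l)) + f i = (\<Sum>l<k. f (i + l)) + f (i + k)"
proof -
  have "(\<Sum>l<k. f (Suc i + l)) + f i = (\<Sum>l<Suc k. f (i + l))"
    unfolding sum.lessThan_Suc_shift by (simp add: add.commute)
  then show ?thesis by simp
qed

lemma sum_window_periodic:
  fixes f :: "nat \<Rightarrow> 'a::cancel_comm_monoid_add"
  assumes "\<And>i. f (i + k) = f i"
  shows "(\<Sum>l<k. f (i + l)) = (\<Sum>l<k. f l)"
proof (induction i)
  case (Suc i)
  have "(\<Sum>l<k. f (Suc i + l)) + f i = (\<Sum>l<k. f (i + l)) + f i"
    unfolding sum_window_Suc assms ..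
  then show ?case using Suc by simp
qed simp

lemma periodic_mod_eq:
  fixes f :: "nat \<Rightarrow> 'a"
  assumes "\<And>i. f (i + k) = f i"
  shows "f (i mod k) = f i"
proof -
  have "f (i mod k + t * k) = f (i mod k)" for t
    by (induction t) (simp_all add: add.commute[of k] add.assoc[symmetric] assms)
  from this[of "i div k"] show ?thesis by simp
qed

lemma frac_periodic_if_integral_windows:
  fixes f :: "nat \<Rightarrow> real"
  assumes "\<And>i. (\<Sum>l<k. f (i + l)) \<in> \<int>"
  shows "frac (f (i + k)) = frac (f i)"
proof -
  have "f (i + k) = f i + ((\<Sum>l<k. f (Suc i + l)) - (\<Sum>l<k. f (i + l)))"
    using sum_window_Suc[of f i k] by simp
  moreover have "(\<Sum>l<k. f (Suc i + l)) - (\<Sum>l<k. f (i + l)) \<in> \<int>"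
    using assms by (intro Ints_diff)
  ultimately show ?thesis by (metis frac_add_int_right)
qed

text \<open>The fractional parts of \<open>f\<close> are \<open>k\<close>-periodic, so all their window sums are the same
  integer \<open>c\<close>, which may be concentrated at the multiples of \<open>k\<close>.\<close>

lemma integral_same_window_sums:
  fixes f :: "nat \<Rightarrow> real"
  assumes k: "0 < k" and windows: "\<And>i. (\<Sum>l<k. f (i + l)) \<in> \<int>"
  obtains c where "c \<in> \<int>"
    "\<And>i. (\<Sum>l<k. of_int \<lfloor>f (i + l)\<rfloor> + (if k dvd i + l then c else 0)) = (\<Sum>l<k. f (i + l))"
proof
  define c where "c = (\<Sum>l<k. frac (f l))"
  define g where "g i = (if k dvd i then c else 0)" for i
  have "c = (\<Sum>l<k. f (0 + l)) - (\<Sum>l<k. of_int \<lfloor>f l\<rfloor>)"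
    by (simp add: c_def frac_def sum_subtractf)
  then show "c \<in> \<int>" using windows[of 0] by (metis Ints_diff Ints_of_int Ints_sum)
  have "(\<Sum>l<k. g l) = (\<Sum>l<k. if l = 0 then c else 0)"
    unfolding g_def by (intro sum.cong) (auto dest: dvd_imp_le)
  then have "(\<Sum>l<k. g l) = (\<Sum>l<k. frac (f l))" using k by (simp add: c_def)
  then have "(\<Sum>l<k. g (i + l)) = (\<Sum>l<k. frac (f (i + l)))" for i
    using sum_window_periodic[of g k i] sum_window_periodic[of "\<lambda>i. frac (f i)" k i]
      frac_periodic_if_integral_windows[of f k, OF windows] by (simp add: g_def)
  then show "(\<Sum>l<k. of_int \<lfloor>f (i + l)\<rfloor> + (if k dvd i + l then c else 0)) = (\<Sum>l<k. f (i + l))" for i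
    by (simp add: sum.distrib g_def frac_def sum_subtractf)
qed

section \<open>Circulant blocks\<close>

lemma circulant_mat_mult_vec:
  fixes v x :: "'a::semiring_0_cancel vec"
  assumes v: "v \<in> carrier_vec n" and x: "x \<in> carrier_vec n" and i: "i < n"
  shows "(circulant_mat v *\<^sub>v x) $ i = (\<Sum>l<n. v $ l * x $ ((i + l) mod n))"
proof -
  define f where "f j = v $ ((j + (n - i)) mod n) * x $ (j mod n)" for j
  have f_periodic: "f (j + n) = f j" for j
    using mod_add_self2[of "j + (n - i)" n] by (simp add: f_def add_ac)
  have "(circulant_mat v *\<^sub>v x) $ i = (\<Sum>j<n. f j)"
    using v x i by (simp add: circulant_mat_def scalar_prod_def f_def atLeast0LessThan)
  also have "\<dots> = (\<Sum>l<n. f (i + l))" using sum_window_periodic[of f n i, OF f_periodic] by simp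
  also have "\<dots> = (\<Sum>l<n. v $ l * x $ ((i + l) mod n))"
    using i by (intro sum.cong) (simp_all add: f_def)
  finally show ?thesis .
qed

abbreviation window_mat :: "nat \<Rightarrow> nat \<Rightarrow> real mat" where
  "window_mat n k \<equiv> D_mat n (n - k)"

lemma window_mat_carrier: "window_mat n k \<in> carrier_mat n n"
  by (simp add: D_mat_def circulant_mat_def)

lemma dim_window_mat [simp]: "dim_row (window_mat n k) = n" "dim_col (window_mat n k) = n"
  using window_mat_carrier by auto

lemma elements_window_mat: "elements_mat (window_mat n k) \<subseteq> {0, 1}"
proof -
  have "window_mat n k $$ (i, j) \<in> {0, 1}" if "i < n" "j < n" for i j
    using that by (simp add: D_mat_def circulant_mat_def)
  then show ?thesis using window_mat_carrier[of n k] by fastforce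
qed

lemma window_mat_mult_vec:
  assumes "k \<le> n" "x \<in> carrier_vec n" "i < n"
  shows "(window_mat n k *\<^sub>v x) $ i = (\<Sum>l<k. x $ ((i + l) mod n))"
proof -
  have "(window_mat n k *\<^sub>v x) $ i = (\<Sum>l<n. (if l < k then 1 else 0) * x $ ((i + l) mod n))"
    unfolding D_mat_def using assms by (subst circulant_mat_mult_vec[of _ n]) auto
  also have "\<dots> = (\<Sum>l<k. x $ ((i + l) mod n))"
    using assms(1) by (intro sum.mono_neutral_cong_right) auto
  finally show ?thesis .
qed

lemma window_mat_col_sum:
  assumes k: "k \<le> n" and j: "j < n"
  shows "(\<Sum>i<n. window_mat n k $$ (i, j)) = k"
proof -
  define f :: "nat \<Rightarrow> real" where "f i = unit_vec n j $ (i mod n)" for i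
  have "window_mat n k $$ (i, j) = (\<Sum>l<k. f (i + l))" if i: "i < n" for i
  proof -
    have "window_mat n k $$ (i, j) = (window_mat n k *\<^sub>v unit_vec n j) $ i"
      using mult_mat_unit_vec[OF window_mat_carrier j] i j by simp
    then show ?thesis using window_mat_mult_vec[OF k _ i] by (simp add: f_def)
  qed
  then have "(\<Sum>i<n. window_mat n k $$ (i, j)) = (\<Sum>i<n. \<Sum>l<k. f (i + l))" by simp
  also have "\<dots> = (\<Sum>l<k. \<Sum>i<n. f (l + i))" by (subst sum.swap) (simp add: add.commute)
  also have "\<dots> = (\<Sum>l<k. \<Sum>i<n. f i)"
    by (intro sum.cong sum_window_periodic) (simp_all add: f_def)
  also have "(\<Sum>i<n. f i) = 1"
    using j by (simp add: f_def unit_vec_def)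
  finally show ?thesis by simp
qed

lemma balanced_window_mat:
  assumes "0 < k" "k \<le> n"
  shows "balanced_mat n (window_mat n k) (vec n (\<lambda>_. 1 / k))"
proof
  let ?u = "vec n (\<lambda>_. 1 / k)"
  show "window_mat n k *\<^sub>v ?u = ones_vec n"
    using assms by (intro eq_vecI) (simp_all add: window_mat_mult_vec del: index_mult_mat_vec)
  show "transpose_mat (window_mat n k) *\<^sub>v ?u = ones_vec n"
  proof (rule eq_vecI)
    fix j assume "j < dim_vec (ones_vec n)"
    then have j: "j < n" by simp
    then have "(transpose_mat (window_mat n k) *\<^sub>v ?u) $ j = (\<Sum>i<n. window_mat n k $$ (i, j)) / k"
      by (simp add: scalar_prod_def sum_divide_distrib atLeast0LessThan)
    then show "(transpose_mat (window_mat n k) *\<^sub>v ?u) $ j = ones_vec n $ j"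
      using window_mat_col_sum[OF assms(2) j] assms(1) j by simp
  qed simp
qed (use assms in \<open>auto intro: window_mat_carrier\<close>)

lemma window_mat_kernel_periodic:
  assumes k: "k \<le> n" "0 < n" and x: "x \<in> mat_kernel (window_mat n k)"
  shows "x $ ((i + k) mod n) = x $ (i mod n)"
proof -
  have x_carrier: "x \<in> carrier_vec n" and kernel: "window_mat n k *\<^sub>v x = 0\<^sub>v n"
    using mat_kernelD[OF window_mat_carrier x] by simp_all
  have window: "(\<Sum>l<k. x $ ((i + l) mod n)) = 0" for i
    using window_mat_mult_vec[OF k(1) x_carrier, of "i mod n"] kernel k(2)
    by (simp add: mod_add_left_eq)
  show ?thesis using sum_window_Suc[of "\<lambda>i. x $ (i mod n)" i k] by (simp only: window)
qed

lemma window_mat_kernel_eq_0: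
  assumes k: "0 < k" "k \<le> n" and x: "x \<in> mat_kernel (window_mat n k)"
    and initial: "\<And>i. i < k - 1 \<Longrightarrow> x $ i = 0"
  shows "x = 0\<^sub>v n"
proof -
  have x_carrier: "x \<in> carrier_vec n" and kernel: "window_mat n k *\<^sub>v x = 0\<^sub>v n"
    using mat_kernelD[OF window_mat_carrier x] by simp_all
  have "x $ (k - 1) = (\<Sum>l<k. x $ l)"
    using k(1) initial sum.lessThan_Suc[of "\<lambda>l. x $ l" "k - 1"] by simp
  also have "\<dots> = (window_mat n k *\<^sub>v x) $ 0"
    using window_mat_mult_vec[OF k(2) x_carrier, of 0] k by simp
  also have "\<dots> = 0" using kernel k by simp
  finally have zero: "x $ i = 0" if "i < k" for i
    using initial[of i] that by (cases "i = k - 1") auto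
  have "x $ i = 0" if i: "i < n" for i
  proof -
    have "x $ i = x $ (i mod k)"
      using periodic_mod_eq[of "\<lambda>i. x $ (i mod n)" k i] window_mat_kernel_periodic[OF k(2) _ x] i
      by (simp add: order.strict_trans1[OF mod_less_eq_dividend])
    then show ?thesis using zero k(1) by simp
  qed
  then show ?thesis using x_carrier by (intro eq_vecI) auto
qed

lemma rank_window_mat_ge:
  assumes "0 < k" "k \<le> n"
  shows "n - k + 1 \<le> vec_space.rank n (window_mat n k)"
  using rank_ge_if_kernel_initial_zeros[OF window_mat_carrier[of n k], of "k - 1"]
    window_mat_kernel_eq_0[OF assms] assms by (simp add: Suc_diff_le)

lemma integral_preimages_window_mat:
  assumes k: "0 < k" "k \<le> n" "k dvd n"
  shows "integral_preimages (window_mat n k)"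
  unfolding integral_preimages_def
proof (intro ballI impI)
  let ?N = "window_mat n k"
  fix x assume "x \<in> carrier_vec (dim_col ?N)" and integral: "integral_vec (?N *\<^sub>v x)"
  then have x: "x \<in> carrier_vec n" by simp
  have "(\<Sum>l<k. x $ ((i + l) mod n)) \<in> \<int>" for i
  proof -
    have "(\<Sum>l<k. x $ ((i + l) mod n)) = (?N *\<^sub>v x) $ (i mod n)"
      using window_mat_mult_vec[OF k(2) x, of "i mod n"] k by (simp add: mod_add_left_eq)
    then show ?thesis using integral k by (auto simp: vec_set_def simp del: index_mult_mat_vec)
  qed
  then obtain c where c_int: "c \<in> \<int>"
    and c_windows: "\<And>i. (\<Sum>l<k. of_int \<lfloor>x $ ((i + l) mod n)\<rfloor> +
      (if k dvd i + l then c else 0)) = (\<Sum>l<k. x $ ((i + l) mod n))"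
    using integral_same_window_sums[OF k(1), of "\<lambda>i. x $ (i mod n)"] by auto
  define y where "y = vec n (\<lambda>i. of_int \<lfloor>x $ i\<rfloor> + (if k dvd i then c else 0))"
  have y: "y \<in> carrier_vec n" by (simp add: y_def)
  have "(?N *\<^sub>v y) $ i = (?N *\<^sub>v x) $ i" if "i < n" for i
    using window_mat_mult_vec[OF k(2) y that] window_mat_mult_vec[OF k(2) x that] c_windows[of i] k
    by (simp add: y_def dvd_mod_iff)
  then have "?N *\<^sub>v y = ?N *\<^sub>v x" by (intro eq_vecI) simp_all
  moreover have "integral_vec y" using c_int by (auto simp: y_def vec_set_def)
  ultimately show "\<exists>y\<in>carrier_vec (dim_col ?N). integral_vec y \<and> ?N *\<^sub>v y = ?N *\<^sub>v x"
    using y by auto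
qed

lemma quotient_le_diff_plus_1:
  assumes "0 < k" "k \<le> n"
  shows "real n / real k \<le> n - k + 1"
    and "1 < k \<Longrightarrow> k < n \<Longrightarrow> real n / real k < n - k + 1"
proof -
  have diff: "real k * (n - k + 1) - n = (real k - 1) * (real n - real k)"
    using assms(2) by (simp add: of_nat_diff algebra_simps)
  moreover have "0 \<le> (real k - 1) * (real n - real k)"
    using assms by (intro mult_nonneg_nonneg) auto
  ultimately have "real n \<le> real k * (n - k + 1)" by simp
  then show "real n / real k \<le> n - k + 1"
    using assms(1) by (simp add: divide_le_eq mult.commute)
  assume "1 < k" "k < n"
  then have "0 < (real k - 1) * (real n - real k)" by simp
  then have "real n < real k * (n - k + 1)" using diff by simp
  then show "real n / real k < n - k + 1"
    using assms(1) by (simp add: divide_less_eq mult.commute)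
qed

lemma sum_quotients_less:
  fixes k n :: "'a \<Rightarrow> nat"
  assumes "finite I" and "\<And>i. i \<in> I \<Longrightarrow> 0 < k i \<and> k i \<le> n i"
    and "p \<in> I" "1 < k p" "k p < n p"
  shows "(\<Sum>i\<in>I. n i / k i) < real (\<Sum>i\<in>I. n i - k i + 1)"
  unfolding of_nat_sum using assms quotient_le_diff_plus_1
  by (intro sum_strict_mono_ex1) (simp, blast+)

lemma circulant_block_diag_eq:
  "circulant_block_diag m k n = diag_block_mat (map (\<lambda>i. window_mat (n i) (k i)) [1..<m + 1])"
  by (simp add: circulant_block_diag_def)

lemma sum_list_upt_1: "(\<Sum>i\<leftarrow>[1..<m + 1]. f i) = (\<Sum>i = 1..m. f i)"
  for f :: "nat \<Rightarrow> 'a::comm_monoid_add"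
  by (simp add: interv_sum_list_conv_sum_set_nat atLeastLessThanSuc_atLeastAtMost del: upt_Suc)

lemma balanced_circulant_block_diag:
  assumes "\<And>i. i \<in> {1..m} \<Longrightarrow> 0 < k i \<and> k i \<le> n i"
  obtains u where "balanced_mat (\<Sum>i = 1..m. n i) (circulant_block_diag m k n) u"
    "ones_vec (\<Sum>i = 1..m. n i) \<bullet> u = (\<Sum>i = 1..m. n i / k i)"
proof -
  have "balanced_mat (n i) (window_mat (n i) (k i)) (vec (n i) (\<lambda>_. 1 / k i))"
    if "i \<in> set [1..<m + 1]" for i
    using assms that by (intro balanced_window_mat) auto
  moreover have "ones_vec (n i) \<bullet> vec (n i) (\<lambda>_. 1 / k i) = n i / k i" for i
    by (simp add: scalar_prod_def)
  ultimately show thesis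
    using that balanced_mat_diag_block_mat[of "[1..<m + 1]" n "\<lambda>i. window_mat (n i) (k i)"
      "\<lambda>i. vec (n i) (\<lambda>_. 1 / k i)"]
    unfolding circulant_block_diag_eq sum_list_upt_1 by auto
qed

lemma integral_preimages_circulant_block_diag:
  assumes "\<And>i. i \<in> {1..m} \<Longrightarrow> 0 < k i \<and> k i \<le> n i \<and> k i dvd n i"
  shows "integral_preimages (circulant_block_diag m k n)"
  unfolding circulant_block_diag_eq using assms
  by (intro integral_preimages_diag_block_mat)
    (auto intro!: integral_preimages_window_mat simp del: upt_Suc)

lemma elements_circulant_block_diag: "elements_mat (circulant_block_diag m k n) \<subseteq> {0, 1}"
  unfolding circulant_block_diag_eq
  by (rule order_trans[OF elements_diag_block_mat]) (use elements_window_mat in auto)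

lemma rank_circulant_block_diag_ge:
  assumes "\<And>i. i \<in> {1..m} \<Longrightarrow> 0 < k i \<and> k i \<le> n i"
  shows "(\<Sum>i = 1..m. n i - k i + 1) \<le> rank_real (circulant_block_diag m k n)"
proof -
  have "square_mat A" if "A \<in> set (map (\<lambda>i. window_mat (n i) (k i)) [1..<m + 1])" for A
    using that by auto
  then have "rank_real (circulant_block_diag m k n) =
      (\<Sum>i = 1..m. vec_space.rank (n i) (window_mat (n i) (k i)))"
    unfolding circulant_block_diag_eq sum_list_upt_1[symmetric]
    by (subst rank_diag_block_mat) (simp_all add: comp_def del: upt_Suc)
  moreover have "(\<Sum>i = 1..m. n i - k i + 1) \<le>
      (\<Sum>i = 1..m. vec_space.rank (n i) (window_mat (n i) (k i)))"
    using assms by (intro sum_mono rank_window_mat_ge) auto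
  ultimately show ?thesis by simp
qed

theorem theorem1p4:
  fixes m :: nat and k n :: "nat \<Rightarrow> nat" and M :: "real mat"
  assumes "m \<ge> 1"
    and "\<And>i. i \<in> {1..m} \<Longrightarrow> n i \<ge> k i \<and> k i > 0"
    and "M = complement_mat (circulant_block_diag m k n)"
    and "\<And>i. i \<in> {1..m} \<Longrightarrow> k i dvd n i"
    and "\<exists>i\<in>{1..m}. n i > k i \<and> k i > 1"
  shows "rank_bin M \<ge> rank_real M + 1"
proof -
  let ?N = "circulant_block_diag m k n" and ?d = "\<Sum>i = 1..m. n i"
  obtain p where p: "p \<in> {1..m}" "k p < n p" "1 < k p" using assms(5) by blast
  obtain u where "balanced_mat ?d ?N u" and weight_eq: "ones_vec ?d \<bullet> u = (\<Sum>i = 1..m. n i / k i)"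
    using balanced_circulant_block_diag[of m k n] assms(2) by blast
  then interpret balanced_mat ?d ?N u by simp
  have "1 < n p / k p" using p by simp
  also have "\<dots> \<le> weight" unfolding weight_eq using p(1) by (intro member_le_sum) auto
  finally have "1 < weight" .
  moreover have "weight < real (\<Sum>i = 1..m. n i - k i + 1)"
    unfolding weight_eq using p assms(2) by (intro sum_quotients_less) auto
  then have "weight < vec_space.rank ?d ?N"
    using rank_circulant_block_diag_ge[of m k n] assms(2) carrier_matD(1)[OF N_carrier]
    by (auto elim!: order_less_le_trans simp del: of_nat_sum)
  ultimately have "vec_space.rank ?d M < rank_bin M"
    unfolding assms(3) using assms(2,4)
    by (intro rank_complement_less_rank_bin integral_preimages_circulant_block_diag
        elements_circulant_block_diag) auto
  then show ?thesis using complement_carrier assms(3) by simp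
qed

end
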